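(* Assume $\lVert I-M^{-1}A\rVert_B<1$. Let $$\widehat M^{-1}B = V\,\mathrm{diag}(\mu_1,\dots,\mu_n)\,V^{-1}$$ be a $B$-unitary diagonalization of $\widehat M^{-1}B$ with sorted eigenvalues $\mu_1\le\dots\le\mu_n$ and corresponding $B$-unitary eigenvector matrix $V=[v_1\ \cdots\ v_n]$. Furthermore, let $I-\widehat M^{-1}B$ be nonsingular and let $\hat P,\hat R\in\mathbb{C}^{n\times n_c}$ be such that $$\mathcal R(\hat P)=\mathcal R([v_1\ \cdots\ v_{n_c}])\quad\text{and}\quad \mathcal N(\hat R^HA)=\mathcal R([v_{n_c+1}\ \cdots\ v_n]).$$ Then for $(\nu_1,\nu_2)\in\{(0,1),(1,0),(1,1)\}$ and all $P,R\in\mathbb{C}^{n\times n_c}$ such that $R^HAP$ is nonsingular, $$\lVert E_+^{\nu_1,\nu_2}(\hat P,\hat R)\rVert_B^2=(1-\mu_{n_c+1})^{\nu_1+\nu_2}\le\lVert E_+^{\nu_1,\nu_2}(P,R)\rVert_B^2.$$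
   Context: $A,M\in\mathbb{C}^{n\times n}$ are nonsingular, $B\in\mathbb{C}^{n\times n}$ is Hermitian positive definite (HPD), and $1\le n_c<n$. $\mathcal R(\cdot)$ and $\mathcal N(\cdot)$ denote range and kernel. The $B$-norm is $\lVert x\rVert_B=\sqrt{x^HBx}$ on vectors, and $\lVert C\rVert_B=\sup_{x\ne0}\lVert Cx\rVert_B/\lVert x\rVert_B$ on matrices. The $B$-adjoint of $C\in\mathbb{C}^{n\times n}$ is $C^+=B^{-1}C^HB$. A matrix $V\in\mathbb{C}^{n\times n}$ is $B$-unitary if $V^HBV=I_n$; a $B$-unitary diagonalization of $C$ is $C=VDV^{-1}$ with $V$ $B$-unitary and $D$ diagonal. $\widehat M^{-1}$ denotes the matrix $\widehat M^{-1}=M^{-1}AB^{-1}+B^{-1}A^HM^{-H}-M^{-1}AB^{-1}A^HM^{-H}$, so that $\widehat M^{-1}B=M^{-1}A+(M^{-1}A)^+-M^{-1}A(M^{-1}A)^+$ (a $B$-self-adjoint matrix, with real eigenvalues). For $P,R\in\mathbb{C}^{n\times n_c}$ with $R^HAP$ nonsingular, $\Pi_A(P,R)=P(R^HAP)^{-1}R^HA$, and for $\nu_1,\nu_2\in\mathbb{N}_0$, $E_+^{\nu_1,\nu_2}(P,R)=(I-(M^{-1}A)^+)^{\nu_2}(I-\Pi_A(P,R))(I-M^{-1}A)^{\nu_1}$. *)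

theory Defs
  imports
    "Jordan_Normal_Form.Gauss_Jordan_Elimination"
    "Jordan_Normal_Form.Matrix_Kernel"
    "Jordan_Normal_Form.Schur_Decomposition"
    "HOL.Complex"
begin

text \<open>Only meaningful for nonsingular square matrices; the value is unspecified otherwise.\<close>

definition mat_inv :: "complex mat \<Rightarrow> complex mat" where
  "mat_inv A = the (mat_inverse A)"

lemma mat_inv_inverts:
  assumes A: "A \<in> carrier_mat n n" and inv: "invertible_mat A"
  shows "mat_inv A \<in> carrier_mat n n" "A * mat_inv A = 1\<^sub>m n" "mat_inv A * A = 1\<^sub>m n"
proof -
  from inv obtain C where AC: "A * C = 1\<^sub>m n" and CA: "C * A = 1\<^sub>m (dim_row C)"
    using A unfolding invertible_mat_def inverts_mat_def by auto
  have "dim_col C = n" using arg_cong[OF AC, of dim_col] by simp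
  moreover have "dim_row C = n" using arg_cong[OF CA, of dim_col] A by simp
  ultimately have C: "C \<in> carrier_mat n n" by auto
  have "A \<in> Units (ring_mat TYPE(complex) n ())"
    using A C AC CA unfolding Units_def ring_mat_def by auto
  then obtain X where "mat_inverse A = Some X"
    using mat_inverse(1)[OF A] by fastforce
  then show "mat_inv A \<in> carrier_mat n n" "A * mat_inv A = 1\<^sub>m n" "mat_inv A * A = 1\<^sub>m n"
    using mat_inverse(2)[OF A] unfolding mat_inv_def by auto
qed

definition mat_range :: "complex mat \<Rightarrow> complex vec set" where
  "mat_range A = (\<lambda>x. A *\<^sub>v x) ` carrier_vec (dim_col A)"

lemma mat_range_col_space:
  assumes "A \<in> carrier_mat n m"
  shows "mat_range A = vec_space.col_space n A"
  using vec_space.col_space_eq[OF assms] assms unfolding mat_range_def by auto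

text \<open>The columns of \<open>V\<close> with (0-based) index in \<open>{i..<j}\<close>. With 1-based column names
  \<open>v_1, ..., v_n\<close> this is \<open>[v_(i+1) ... v_j]\<close>.\<close>

definition cols_between :: "complex mat \<Rightarrow> nat \<Rightarrow> nat \<Rightarrow> complex mat" where
  "cols_between V i j = mat_of_cols (dim_row V) (map (col V) [i..<j])"

text \<open>\<open>(B *\<^sub>v x) \<bullet>c x\<close> is \<open>x^H B x\<close>: \<open>\<bullet>c\<close> conjugates its right argument.
  It is real for Hermitian \<open>B\<close>, so taking the real part loses nothing below.\<close>

definition hpd :: "nat \<Rightarrow> complex mat \<Rightarrow> bool" where
  "hpd n B \<longleftrightarrow> B \<in> carrier_mat n n \<and> mat_adjoint B = B \<and>
     (\<forall>x \<in> carrier_vec n. x \<noteq> 0\<^sub>v n \<longrightarrow> Re ((B *\<^sub>v x) \<bullet>c x) > 0)"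

definition B_norm_vec :: "complex mat \<Rightarrow> complex vec \<Rightarrow> real" where
  "B_norm_vec B x = sqrt (Re ((B *\<^sub>v x) \<bullet>c x))"

definition B_norm :: "complex mat \<Rightarrow> complex mat \<Rightarrow> real" where
  "B_norm B C = (SUP x \<in> carrier_vec (dim_col C) - {0\<^sub>v (dim_col C)}.
     B_norm_vec B (C *\<^sub>v x) / B_norm_vec B x)"

definition B_adjoint :: "complex mat \<Rightarrow> complex mat \<Rightarrow> complex mat" where
  "B_adjoint B C = mat_inv B * mat_adjoint C * B"

definition B_unitary :: "nat \<Rightarrow> complex mat \<Rightarrow> complex mat \<Rightarrow> bool" where
  "B_unitary n B V \<longleftrightarrow> V \<in> carrier_mat n n \<and> mat_adjoint V * B * V = 1\<^sub>m n"

definition B_unitary_diagonalization ::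
  "nat \<Rightarrow> complex mat \<Rightarrow> complex mat \<Rightarrow> complex mat \<Rightarrow> complex mat \<Rightarrow> bool" where
  "B_unitary_diagonalization n B C V D \<longleftrightarrow>
     B_unitary n B V \<and> D \<in> carrier_mat n n \<and> diagonal_mat D \<and> C = V * D * mat_inv V"

text \<open>The matrix written \<open>M^{-1}\<close> with a hat; as such it is defined by the formula below, not as the inverse
  of some previously given matrix.\<close>

definition Mhat_inv :: "complex mat \<Rightarrow> complex mat \<Rightarrow> complex mat \<Rightarrow> complex mat" where
  "Mhat_inv A M B =
     mat_inv M * A * mat_inv B
     + mat_inv B * mat_adjoint A * mat_adjoint (mat_inv M)
     - mat_inv M * A * mat_inv B * mat_adjoint A * mat_adjoint (mat_inv M)"

definition coarse_proj :: "complex mat \<Rightarrow> complex mat \<Rightarrow> complex mat \<Rightarrow> complex mat" where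
  "coarse_proj A P R = P * mat_inv (mat_adjoint R * A * P) * (mat_adjoint R * A)"

definition E_plus ::
  "complex mat \<Rightarrow> complex mat \<Rightarrow> complex mat \<Rightarrow> nat \<Rightarrow> nat \<Rightarrow>
   complex mat \<Rightarrow> complex mat \<Rightarrow> complex mat" where
  "E_plus A M B \<nu>1 \<nu>2 P R =
     (let I = 1\<^sub>m (dim_row A) in
      (I - B_adjoint B (mat_inv M * A)) ^\<^sub>m \<nu>2
      * (I - coarse_proj A P R)
      * (I - mat_inv M * A) ^\<^sub>m \<nu>1)"

end

theory Submission
  imports Defs "HOL-Analysis.L2_Norm"
begin

text \<open>
  Put \<open>S = I - M\<^sup>-\<^sup>1 A\<close> and write \<open>T = S\<^sup>+\<close> for its \<open>B\<close>-adjoint.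
  Then \<open>I - Mhat_inv A M B * B = S T\<close>, so in the \<open>B\<close>-orthonormal coordinates given by \<open>V\<close>
  the operator \<open>S T\<close> is the diagonal of the decreasing numbers \<open>d i = 1 - \<mu> i\<close>, and
  \<open>\<parallel>T x\<parallel>\<^sup>2 = (\<Sum>i. d i * \<bar>x i\<bar>\<^sup>2)\<close>.
  The span of the first \<open>nc + 1\<close> eigenvectors meets the solution set of any \<open>nc\<close> homogeneous
  linear equations nontrivially, in particular the fixed space of the projection
  \<open>Q = I - coarse_proj A P R\<close> or of its adjoint; a vector in the intersection witnesses the
  lower bound. For the optimal pair, \<open>Q\<close> is the coordinate truncation to the trailing
  eigenvectors, which gives the matching upper bound.
\<close>

subsection \<open>Adjoints, inverses and ranges of matrices\<close>

lemma mat_adjoint_dim [simp]: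
  "dim_row (mat_adjoint C) = dim_col C" "dim_col (mat_adjoint C) = dim_row C"
  unfolding mat_adjoint_def by auto

lemma mat_adjoint_carrier [simp]:
  "C \<in> carrier_mat m n \<Longrightarrow> mat_adjoint C \<in> carrier_mat n m"
  by auto

lemma mat_adjoint_mult_carrier:
  "C \<in> carrier_mat n m \<Longrightarrow> D \<in> carrier_mat n l \<Longrightarrow> mat_adjoint C * D \<in> carrier_mat m l"
  by (rule mult_carrier_mat[OF mat_adjoint_carrier])

lemma mat_adjoint_index [simp]:
  "i < dim_col C \<Longrightarrow> j < dim_row C \<Longrightarrow> mat_adjoint C $$ (i, j) = conjugate (C $$ (j, i))"
  unfolding mat_adjoint_def by (auto simp: mat_of_rows_index)

lemma mat_adjoint_adjoint [simp]: "mat_adjoint (mat_adjoint C) = C"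
  by (rule eq_matI) auto

lemma mat_adjoint_one [simp]: "mat_adjoint (1\<^sub>m n :: complex mat) = 1\<^sub>m n"
  by (rule eq_matI) auto

lemma mat_adjoint_minus:
  fixes C D :: "complex mat"
  assumes "C \<in> carrier_mat m n" "D \<in> carrier_mat m n"
  shows "mat_adjoint (C - D) = mat_adjoint C - mat_adjoint D"
  using assms by (intro eq_matI) auto

lemma mat_adjoint_mult:
  fixes C D :: "complex mat"
  assumes "C \<in> carrier_mat m n" "D \<in> carrier_mat n l"
  shows "mat_adjoint (C * D) = mat_adjoint D * mat_adjoint C"
  using assms by (intro eq_matI) (auto simp: scalar_prod_def mult.commute)

lemma cscalar_prod_mat_adjoint:
  fixes C :: "complex mat"
  assumes C: "C \<in> carrier_mat m n" and x: "x \<in> carrier_vec n" and y: "y \<in> carrier_vec m"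
  shows "(C *\<^sub>v x) \<bullet>c y = x \<bullet>c (mat_adjoint C *\<^sub>v y)"
proof -
  have "(C *\<^sub>v x) \<bullet>c y = (\<Sum>i<m. \<Sum>j<n. C $$ (i, j) * x $ j * cnj (y $ i))"
    using assms by (auto simp: scalar_prod_def atLeast0LessThan sum_distrib_right)
  also have "\<dots> = (\<Sum>j<n. \<Sum>i<m. C $$ (i, j) * x $ j * cnj (y $ i))"
    by (rule sum.swap)
  also have "\<dots> = x \<bullet>c (mat_adjoint C *\<^sub>v y)"
    using assms
    by (auto simp: scalar_prod_def atLeast0LessThan sum_distrib_left ac_simps intro!: sum.cong)
  finally show ?thesis .
qed

lemma mult_mat_zero_vec:
  fixes C :: "complex mat"
  shows "C \<in> carrier_mat m n \<Longrightarrow> C *\<^sub>v 0\<^sub>v n = 0\<^sub>v m"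
  by (intro eq_vecI) auto

lemma invertible_matI:
  fixes C :: "complex mat"
  assumes C: "C \<in> carrier_mat n n"
    and inj: "\<And>x. x \<in> carrier_vec n \<Longrightarrow> C *\<^sub>v x = 0\<^sub>v n \<Longrightarrow> x = 0\<^sub>v n"
  shows "invertible_mat C"
proof -
  have "det C \<noteq> 0" using det_0_iff_vec_prod_zero[OF C] inj by blast
  from det_non_zero_imp_unit[OF C this, of "()"]
  obtain D where "D \<in> carrier_mat n n" "D * C = 1\<^sub>m n" "C * D = 1\<^sub>m n"
    unfolding Units_def ring_mat_def by auto
  then show ?thesis using C unfolding invertible_mat_def inverts_mat_def by auto
qed

lemma mat_inv_unique:
  assumes C: "C \<in> carrier_mat n n" and D: "D \<in> carrier_mat n n" and DC: "D * C = 1\<^sub>m n"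
  shows "mat_inv C = D"
proof -
  have CD: "C * D = 1\<^sub>m n" by (rule mat_mult_left_right_inverse[OF D C DC])
  have "invertible_mat C"
    using C D DC CD unfolding invertible_mat_def inverts_mat_def by auto
  note inv = mat_inv_inverts[OF C this]
  have "mat_inv C = D * C * mat_inv C" using inv by (simp add: DC)
  also have "\<dots> = D * (C * mat_inv C)" using C D inv by (intro assoc_mult_mat) auto
  also have "\<dots> = D" using inv D by simp
  finally show ?thesis .
qed

text \<open>If \<open>C\<close> were singular, its transpose would kill some \<open>w\<close> other
  than 0. Writing the conjugate of \<open>w\<close> as \<open>C *\<^sub>v z\<close> turns the
  squared length of \<open>w\<close> into \<open>w \<bullet> (C *\<^sub>v z)\<close>, which vanishes
  once \<open>C\<close> is moved to the left factor.\<close>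

lemma surj_square_mat_inj:
  fixes C :: "complex mat"
  assumes C: "C \<in> carrier_mat n n"
    and surj: "\<And>y. y \<in> carrier_vec n \<Longrightarrow> \<exists>x \<in> carrier_vec n. C *\<^sub>v x = y"
    and x: "x \<in> carrier_vec n" and Cx: "C *\<^sub>v x = 0\<^sub>v n"
  shows "x = 0\<^sub>v n"
proof (rule ccontr)
  assume "x \<noteq> 0\<^sub>v n"
  then have "det C = 0" using det_0_iff_vec_prod_zero[OF C] x Cx by blast
  then have "det (transpose_mat C) = 0" using det_transpose[OF C] by simp
  then obtain w where w: "w \<in> carrier_vec n" "w \<noteq> 0\<^sub>v n" "transpose_mat C *\<^sub>v w = 0\<^sub>v n"
    using det_0_iff_vec_prod_zero[of "transpose_mat C" n] C by auto
  obtain z where z: "z \<in> carrier_vec n" "C *\<^sub>v z = conjugate w"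
    using surj[of "conjugate w"] w by auto
  have "w \<bullet>c w = w \<bullet> (C *\<^sub>v z)" using z by simp
  also have "\<dots> = (transpose_mat C *\<^sub>v w) \<bullet> z"
    using transpose_vec_mult_scalar[OF C z(1) w(1)] by simp
  also have "\<dots> = 0" using w z by simp
  finally show False using w by simp
qed

lemma hpd_invertible:
  assumes "hpd n B" shows "invertible_mat B"
proof (rule invertible_matI)
  show "B \<in> carrier_mat n n" using assms unfolding hpd_def by blast
  fix x :: "complex vec" assume x: "x \<in> carrier_vec n" and "B *\<^sub>v x = 0\<^sub>v n"
  then have "Re ((B *\<^sub>v x) \<bullet>c x) = 0" by simp
  then show "x = 0\<^sub>v n" using assms x unfolding hpd_def by force
qed

text \<open>A combination of a block of columns is a combination of all columns with zero-padded
  coefficients. This lets the ranges of column blocks be described through the full invertible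
  matrix.\<close>

lemma cols_between_mult_vec:
  assumes V: "V \<in> carrier_mat n n" and "i \<le> j" "j \<le> n" and y: "y \<in> carrier_vec (j - i)"
  shows "cols_between V i j *\<^sub>v y = V *\<^sub>v vec n (\<lambda>k. if i \<le> k \<and> k < j then y $ (k - i) else 0)"
    (is "_ = V *\<^sub>v ?e")
proof (rule eq_vecI)
  fix r assume "r < dim_vec (V *\<^sub>v ?e)"
  then have r: "r < n" using V by simp
  have "(cols_between V i j *\<^sub>v y) $ r = (\<Sum>k<j - i. V $$ (r, i + k) * y $ k)"
    using assms r by (auto simp: cols_between_def scalar_prod_def atLeast0LessThan
        mat_of_cols_index intro!: sum.cong)
  also have "\<dots> = (\<Sum>k\<in>{i..<j}. V $$ (r, k) * y $ (k - i))"
    using assms by (intro sum.reindex_bij_witness[of _ "\<lambda>k. k - i" "\<lambda>k. i + k"]) auto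
  also have "\<dots> = (\<Sum>k<n. V $$ (r, k) * ?e $ k)"
    using assms by (intro sum.mono_neutral_cong_left) auto
  also have "\<dots> = (V *\<^sub>v ?e) $ r"
    using V r by (auto simp: scalar_prod_def atLeast0LessThan)
  finally show "(cols_between V i j *\<^sub>v y) $ r = (V *\<^sub>v ?e) $ r" .
qed (use V in \<open>auto simp: cols_between_def\<close>)

subsection \<open>The geometry of a \<open>B\<close>-orthonormal basis\<close>

locale B_unitary_basis =
  fixes n :: nat and B V :: "complex mat"
  assumes hpd: "hpd n B" and unitary: "B_unitary n B V"
begin

text \<open>By \<open>B\<close>-unitarity \<open>mat_adjoint V * B\<close> is the inverse of
  \<open>V\<close> (see \<open>mat_inv_V\<close>), so these are the coefficients of \<open>x\<close>
  with respect to the columns of \<open>V\<close>.\<close>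

definition coord :: "complex vec \<Rightarrow> complex vec" where
  "coord x = (mat_adjoint V * B) *\<^sub>v x"

lemma B_carrier [simp, intro]: "B \<in> carrier_mat n n"
  using hpd unfolding hpd_def by blast

lemma V_carrier [simp, intro]: "V \<in> carrier_mat n n"
  using unitary unfolding B_unitary_def by blast

lemma adjoint_B [simp]: "mat_adjoint B = B"
  using hpd unfolding hpd_def by blast

lemmas inv_B = mat_inv_inverts[OF B_carrier hpd_invertible[OF hpd]]

lemma VB_carrier [simp, intro]: "mat_adjoint V * B \<in> carrier_mat n n"
  by (rule mat_adjoint_mult_carrier[OF V_carrier B_carrier])

lemma VB_V: "mat_adjoint V * B * V = 1\<^sub>m n"
  using unitary unfolding B_unitary_def by blast

lemma V_VB: "V * (mat_adjoint V * B) = 1\<^sub>m n"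
  using mat_mult_left_right_inverse[OF _ _ VB_V] by simp

lemma mat_inv_V: "mat_inv V = mat_adjoint V * B"
  by (rule mat_inv_unique[OF V_carrier VB_carrier VB_V])

lemma coord_carrier [simp, intro]: "coord x \<in> carrier_vec n"
  unfolding coord_def using VB_carrier by (metis carrier_matD(1) carrier_vecI dim_mult_mat_vec)

lemma dim_coord [simp]: "dim_vec (coord x) = n"
  by (rule carrier_vecD[OF coord_carrier])

lemma coord_V [simp]: "c \<in> carrier_vec n \<Longrightarrow> coord (V *\<^sub>v c) = c"
  unfolding coord_def by (subst assoc_mult_mat_vec[symmetric, of _ n n _ n]) (auto simp: VB_V)

lemma V_coord [simp]: "x \<in> carrier_vec n \<Longrightarrow> V *\<^sub>v coord x = x"
  unfolding coord_def by (subst assoc_mult_mat_vec[symmetric, of _ n n _ n]) (auto simp: V_VB)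

lemma coord_add:
  "x \<in> carrier_vec n \<Longrightarrow> y \<in> carrier_vec n \<Longrightarrow> coord (x + y) = coord x + coord y"
  unfolding coord_def by (rule mult_add_distrib_mat_vec[OF VB_carrier])

lemma coord_minus:
  "x \<in> carrier_vec n \<Longrightarrow> y \<in> carrier_vec n \<Longrightarrow> coord (x - y) = coord x - coord y"
  unfolding coord_def by (rule mult_minus_distrib_mat_vec[OF VB_carrier])

lemma coord_zero [simp]: "coord (0\<^sub>v n) = 0\<^sub>v n"
  unfolding coord_def by (rule mult_mat_zero_vec[OF VB_carrier])

lemma coord_eqI:
  assumes "x \<in> carrier_vec n" "y \<in> carrier_vec n" "\<And>i. i < n \<Longrightarrow> coord x $ i = coord y $ i"
  shows "x = y"
proof -
  have "coord x = coord y"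
    using assms(3) by (intro eq_vecI) auto
  then have "V *\<^sub>v coord x = V *\<^sub>v coord y" by simp
  then show ?thesis using assms by simp
qed

section \<open>The \<open>B\<close>-inner product, its norm and its adjoint\<close>

definition ip :: "complex vec \<Rightarrow> complex vec \<Rightarrow> complex" where
  "ip x y = (B *\<^sub>v x) \<bullet>c y"

abbreviation nrm :: "complex vec \<Rightarrow> real" where
  "nrm \<equiv> B_norm_vec B"

text \<open>Parseval's identity for the basis \<open>V\<close>: after expanding \<open>y\<close> as
  \<open>V *\<^sub>v coord y\<close>, moving \<open>V\<close> to the other side produces exactly
  \<open>coord x\<close>.\<close>

lemma ip_coord:
  assumes x: "x \<in> carrier_vec n" and y: "y \<in> carrier_vec n"
  shows "ip x y = (\<Sum>i<n. coord x $ i * cnj (coord y $ i))"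
proof -
  have "ip x y = (B *\<^sub>v x) \<bullet>c (V *\<^sub>v coord y)" using y by (simp add: ip_def)
  also have "\<dots> = coord x \<bullet>c coord y"
  proof -
    have "(mat_adjoint V *\<^sub>v (B *\<^sub>v x)) \<bullet>c coord y
      = (B *\<^sub>v x) \<bullet>c (mat_adjoint (mat_adjoint V) *\<^sub>v coord y)"
      using x by (intro cscalar_prod_mat_adjoint[of _ n n]) (auto intro: mult_mat_vec_carrier)
    moreover have "mat_adjoint V *\<^sub>v (B *\<^sub>v x) = coord x"
      unfolding coord_def using x by (intro assoc_mult_mat_vec[symmetric, of _ n n _ n]) auto
    ultimately show ?thesis by simp
  qed
  also have "\<dots> = (\<Sum>i<n. coord x $ i * cnj (coord y $ i))"
    by (auto simp: scalar_prod_def atLeast0LessThan)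
  finally show ?thesis .
qed

lemma ip_diag_coord:
  assumes "x \<in> carrier_vec n"
  shows "ip x x = of_real (\<Sum>i<n. (cmod (coord x $ i))\<^sup>2)"
  unfolding ip_coord[OF assms assms] by (simp add: complex_norm_square del: of_real_power)

lemma nrm_coord:
  assumes "x \<in> carrier_vec n"
  shows "nrm x = L2_set (\<lambda>i. cmod (coord x $ i)) {..<n}"
  using ip_diag_coord[OF assms] unfolding B_norm_vec_def L2_set_def ip_def by simp

lemma nrm_sq:
  assumes "x \<in> carrier_vec n"
  shows "(nrm x)\<^sup>2 = (\<Sum>i<n. (cmod (coord x $ i))\<^sup>2)"
  unfolding nrm_coord[OF assms] L2_set_def by (simp add: sum_nonneg)

lemma nrm_sq_ip: "x \<in> carrier_vec n \<Longrightarrow> (nrm x)\<^sup>2 = Re (ip x x)"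
  by (simp add: nrm_sq ip_diag_coord)

lemma nrm_nonneg: "x \<in> carrier_vec n \<Longrightarrow> 0 \<le> nrm x"
  by (simp add: nrm_coord)

lemma nrm_pos:
  assumes "x \<in> carrier_vec n" "x \<noteq> 0\<^sub>v n"
  shows "0 < nrm x"
  using hpd assms unfolding hpd_def B_norm_vec_def by simp

lemma cauchy_schwarz:
  assumes "x \<in> carrier_vec n" "y \<in> carrier_vec n"
  shows "Re (ip x y) \<le> nrm x * nrm y"
proof -
  have "Re (ip x y) \<le> cmod (ip x y)" by (rule complex_Re_le_cmod)
  also have "\<dots> \<le> (\<Sum>i<n. \<bar>cmod (coord x $ i)\<bar> * \<bar>cmod (coord y $ i)\<bar>)"
    unfolding ip_coord[OF assms] by (rule order_trans[OF norm_sum]) (simp add: norm_mult)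
  also have "\<dots> \<le> nrm x * nrm y"
    unfolding nrm_coord[OF assms(1)] nrm_coord[OF assms(2)] by (rule L2_set_mult_ineq)
  finally show ?thesis .
qed

lemma B_adjoint_carrier [simp]: "C \<in> carrier_mat n n \<Longrightarrow> B_adjoint B C \<in> carrier_mat n n"
  unfolding B_adjoint_def using inv_B(1) by (intro mult_carrier_mat[of _ n n]) auto

text \<open>Justifies the formula behind \<open>B_adjoint\<close>: moving \<open>C\<close> across
  the standard product gives \<open>mat_adjoint C\<close> applied to \<open>B *\<^sub>v y\<close>,
  and inserting \<open>B * mat_inv B\<close> in front restores the \<open>B\<close>-product.\<close>

lemma ip_adjoint:
  assumes C: "C \<in> carrier_mat n n" and x: "x \<in> carrier_vec n" and y: "y \<in> carrier_vec n"
  shows "ip (C *\<^sub>v x) y = ip x (B_adjoint B C *\<^sub>v y)"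
proof -
  have CH: "mat_adjoint C \<in> carrier_mat n n" using C by simp
  have By: "B *\<^sub>v y \<in> carrier_vec n" using y by (rule mult_mat_vec_carrier[OF B_carrier])
  have Cx: "C *\<^sub>v x \<in> carrier_vec n" using C x by (rule mult_mat_vec_carrier)
  have CBy: "mat_adjoint C *\<^sub>v (B *\<^sub>v y) \<in> carrier_vec n"
    using CH By by (rule mult_mat_vec_carrier)
  have "ip (C *\<^sub>v x) y = (C *\<^sub>v x) \<bullet>c (B *\<^sub>v y)"
    unfolding ip_def using cscalar_prod_mat_adjoint[OF B_carrier Cx y] by simp
  also have "\<dots> = x \<bullet>c (mat_adjoint C *\<^sub>v (B *\<^sub>v y))"
    by (rule cscalar_prod_mat_adjoint[OF C x By])
  also have "mat_adjoint C *\<^sub>v (B *\<^sub>v y) = (B * mat_inv B) *\<^sub>v (mat_adjoint C *\<^sub>v (B *\<^sub>v y))"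
    using inv_B CBy by simp
  also have "\<dots> = B *\<^sub>v (B_adjoint B C *\<^sub>v y)"
    unfolding B_adjoint_def using inv_B(1) CH y By CBy C
    by (simp add: assoc_mult_mat_vec[of _ n n _ n] mult_carrier_mat[of _ n n _ n])
  also have "x \<bullet>c \<dots> = ip x (B_adjoint B C *\<^sub>v y)"
    unfolding ip_def
    using cscalar_prod_mat_adjoint[OF B_carrier x, of "B_adjoint B C *\<^sub>v y"]
      mult_mat_vec_carrier[OF B_adjoint_carrier[OF C] y] by simp
  finally show ?thesis .
qed

text \<open>\<open>B_norm\<close> is a real supremum, which is informative only for a set bounded
  above. Any finite bound suffices, so a crude one is used.\<close>

lemma operator_bounded:
  assumes C: "C \<in> carrier_mat n n"
  shows "\<exists>K. \<forall>x \<in> carrier_vec n. nrm (C *\<^sub>v x) \<le> K * nrm x"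
proof -
  \<comment> \<open>\<open>W\<close> is the matrix of \<open>C\<close> in the basis
    \<open>V\<close>; the sum of the moduli of its entries will serve as the bound.\<close>
  define W where "W = mat_adjoint V * B * C * V"
  have W: "W \<in> carrier_mat n n" unfolding W_def using C by (intro mult_carrier_mat[of _ n n] VB_carrier) auto
  have W_coord: "coord (C *\<^sub>v x) = W *\<^sub>v coord x" if x: "x \<in> carrier_vec n" for x
  proof -
    have "W *\<^sub>v coord x = (mat_adjoint V * B * C) *\<^sub>v (V *\<^sub>v coord x)"
      unfolding W_def using mult_carrier_mat[OF VB_carrier C]
      by (intro assoc_mult_mat_vec[of _ n n _ n]) auto
    also have "\<dots> = coord (C *\<^sub>v x)"
      unfolding coord_def[of "C *\<^sub>v x"] using C x
      by (simp add: assoc_mult_mat_vec[OF VB_carrier C])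
    finally show ?thesis by simp
  qed
  define K where "K = (\<Sum>i<n. \<Sum>j<n. cmod (W $$ (i, j)))"
  have "nrm (C *\<^sub>v x) \<le> K * nrm x" if x: "x \<in> carrier_vec n" for x
  proof -
    have "nrm (C *\<^sub>v x) \<le> (\<Sum>i<n. cmod (coord (C *\<^sub>v x) $ i))"
      using C x by (subst nrm_coord) (auto intro: L2_set_le_sum)
    also have "\<dots> = (\<Sum>i<n. cmod (\<Sum>j<n. W $$ (i, j) * coord x $ j))"
      using W unfolding W_coord[OF x]
      by (intro sum.cong) (auto simp: scalar_prod_def atLeast0LessThan)
    also have "\<dots> \<le> (\<Sum>i<n. \<Sum>j<n. cmod (W $$ (i, j)) * nrm x)"
    proof (intro sum_mono order_trans[OF norm_sum])
      fix i j assume "j \<in> {..<n}"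
      then have "cmod (coord x $ j) \<le> nrm x"
        unfolding nrm_coord[OF x] by (intro member_le_L2_set[where f = "\<lambda>i. cmod (coord x $ i)"]) auto
      then show "cmod (W $$ (i, j) * coord x $ j) \<le> cmod (W $$ (i, j)) * nrm x"
        by (simp add: norm_mult mult_left_mono)
    qed
    also have "\<dots> = K * nrm x" unfolding K_def by (simp add: sum_distrib_right)
    finally show ?thesis .
  qed
  then show ?thesis by blast
qed

lemma nrm_mult_le:
  assumes C: "C \<in> carrier_mat n n" and x: "x \<in> carrier_vec n"
  shows "nrm (C *\<^sub>v x) \<le> B_norm B C * nrm x"
proof (cases "x = 0\<^sub>v n")
  case True
  then show ?thesis using C by (simp add: mult_mat_zero_vec nrm_coord L2_set_def)
next
  case False
  obtain K where K: "\<And>x. x \<in> carrier_vec n \<Longrightarrow> nrm (C *\<^sub>v x) \<le> K * nrm x"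
    using operator_bounded[OF C] by blast
  have "bdd_above ((\<lambda>x. nrm (C *\<^sub>v x) / nrm x) ` (carrier_vec n - {0\<^sub>v n}))"
    using K nrm_pos by (intro bdd_aboveI2[where M = K]) (auto simp: divide_le_eq)
  then have "nrm (C *\<^sub>v x) / nrm x \<le> B_norm B C"
    unfolding B_norm_def using C x False by (intro cSUP_upper2[where x = x]) auto
  then show ?thesis using nrm_pos[OF x False] by (simp add: divide_le_eq)
qed

text \<open>The condition \<open>0 < n\<close> makes the index set of the supremum nonempty.\<close>

lemma B_norm_le:
  assumes C: "C \<in> carrier_mat n n" and "0 < n"
    and K: "\<And>x. x \<in> carrier_vec n \<Longrightarrow> nrm (C *\<^sub>v x) \<le> K * nrm x"
  shows "B_norm B C \<le> K"
proof -
  have "unit_vec n 0 \<in> carrier_vec n - {0\<^sub>v n :: complex vec}"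
    using \<open>0 < n\<close> by auto
  then have "carrier_vec n - {0\<^sub>v n :: complex vec} \<noteq> {}" by blast
  then show ?thesis
    unfolding B_norm_def using C K nrm_pos by (intro cSUP_least) (auto simp: divide_le_eq)
qed

lemma B_norm_nonneg:
  assumes C: "C \<in> carrier_mat n n" and "0 < n"
  shows "0 \<le> B_norm B C"
proof -
  have u: "unit_vec n 0 \<in> carrier_vec n" "unit_vec n 0 \<noteq> (0\<^sub>v n :: complex vec)"
    using \<open>0 < n\<close> by auto
  have "0 \<le> nrm (C *\<^sub>v unit_vec n 0)" using C by (intro nrm_nonneg) auto
  also have "\<dots> \<le> B_norm B C * nrm (unit_vec n 0)" by (rule nrm_mult_le[OF C u(1)])
  finally show ?thesis using nrm_pos[OF u] by (simp add: zero_le_mult_iff)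
qed

text \<open>Translates the range and kernel conditions on the optimal pair into vanishing of
  coordinates.\<close>

lemma mat_range_cols_between:
  assumes "i \<le> j" "j \<le> n"
  shows "mat_range (cols_between V i j) =
    {x \<in> carrier_vec n. \<forall>k<n. k \<notin> {i..<j} \<longrightarrow> coord x $ k = 0}"
proof (intro equalityI subsetI)
  let ?e = "\<lambda>y. vec n (\<lambda>k. if i \<le> k \<and> k < j then y $ (k - i) else 0) :: complex vec"
  have dim: "dim_col (cols_between V i j) = j - i" by (simp add: cols_between_def)
  {
    fix x assume "x \<in> mat_range (cols_between V i j)"
    then obtain y where "y \<in> carrier_vec (j - i)" "x = V *\<^sub>v ?e y"
      unfolding mat_range_def dim using cols_between_mult_vec[OF V_carrier assms] by auto
    then show "x \<in> {x \<in> carrier_vec n. \<forall>k<n. k \<notin> {i..<j} \<longrightarrow> coord x $ k = 0}"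
      using mult_mat_vec_carrier[OF V_carrier, of "?e y"] by auto
  next
    fix x assume x: "x \<in> {x \<in> carrier_vec n. \<forall>k<n. k \<notin> {i..<j} \<longrightarrow> coord x $ k = 0}"
    define y where "y = vec (j - i) (\<lambda>k. coord x $ (i + k))"
    have "?e y = coord x"
      using x assms by (intro eq_vecI) (auto simp: y_def)
    then have "cols_between V i j *\<^sub>v y = x"
      using cols_between_mult_vec[OF V_carrier assms, of y] x by (simp add: y_def)
    then show "x \<in> mat_range (cols_between V i j)"
      unfolding mat_range_def dim by (auto simp: y_def intro!: image_eqI[of _ _ y])
  }
qed

text \<open>The constraints \<open>F x = 0\<close> and \<open>coord x $ i = 0\<close> for \<open>i > m\<close> are \<open>n - 1\<close> linear equations;
  a zero row at index \<open>m\<close> makes the system square and singular.\<close>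

lemma exists_vec_in_leading_span:
  assumes F: "F \<in> carrier_mat m n" and "m < n"
  obtains x where "x \<in> carrier_vec n" "x \<noteq> 0\<^sub>v n" "F *\<^sub>v x = 0\<^sub>v m"
    "\<And>i. m < i \<Longrightarrow> i < n \<Longrightarrow> coord x $ i = 0"
proof -
  \<comment> \<open>The unknown is the coordinate vector \<open>y\<close> of the desired vector
    \<open>V *\<^sub>v y\<close>. Hence \<open>F\<close> enters through \<open>F * V\<close>, and
    the vanishing of coordinate \<open>i\<close> is the equation with row
    \<open>unit_vec n i\<close>.\<close>
  define c where "c i = (if i < m then row (F * V) i else unit_vec n i)" for i
  define W where "W = mat\<^sub>r n n (\<lambda>i. if i = m then 0\<^sub>v n else c i)"
  have FV: "F * V \<in> carrier_mat m n" using F by (rule mult_carrier_mat) auto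
  have c: "c i \<in> carrier_vec n" for i
    using FV by (auto simp: c_def)
  have W: "W \<in> carrier_mat n n" unfolding W_def by simp
  have "det W = 0" unfolding W_def using c \<open>m < n\<close> by (intro det_row_0) auto
  then obtain y where y: "y \<in> carrier_vec n" "y \<noteq> 0\<^sub>v n" "W *\<^sub>v y = 0\<^sub>v n"
    using det_0_iff_vec_prod_zero[OF W] by blast
  have row: "c i \<bullet> y = 0" if "i < n" "i \<noteq> m" for i
  proof -
    have "(W *\<^sub>v y) $ i = row W i \<bullet> y" using W that by auto
    also have "row W i = c i" unfolding W_def using that c by auto
    finally show ?thesis using y that by simp
  qed
  have "(F * V) *\<^sub>v y = 0\<^sub>v m"
  proof (rule eq_vecI)
    fix i assume "i < dim_vec (0\<^sub>v m :: complex vec)"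
    then show "((F * V) *\<^sub>v y) $ i = 0\<^sub>v m $ i"
      using row[of i] \<open>m < n\<close> FV F by (auto simp: c_def)
  qed (use F in simp)
  then have 1: "F *\<^sub>v (V *\<^sub>v y) = 0\<^sub>v m"
    using assoc_mult_mat_vec[OF F V_carrier y(1)] by simp
  have 2: "coord (V *\<^sub>v y) $ i = 0" if "m < i" "i < n" for i
    using row[of i] that y(1) by (auto simp: c_def)
  have 3: "V *\<^sub>v y \<noteq> 0\<^sub>v n"
  proof
    assume "V *\<^sub>v y = 0\<^sub>v n"
    then have "coord (V *\<^sub>v y) = 0\<^sub>v n" by simp
    then show False using y by simp
  qed
  show ?thesis
    using that[of "V *\<^sub>v y"] 1 2 3 mult_mat_vec_carrier[OF V_carrier y(1)] by blast
qed

end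

subsection \<open>Norms of smoothed projections\<close>

text \<open>Isolates what the norm estimates use about the smoother: \<open>S\<close> times its
  \<open>B\<close>-adjoint is diagonal in the basis \<open>V\<close> with decreasing entries
  \<open>d\<close>. In the application \<open>d i\<close> is \<open>1 - \<mu> i\<close>.\<close>

locale smoothed_error = B_unitary_basis +
  fixes S :: "complex mat" and d :: "nat \<Rightarrow> real"
  assumes S_carrier [simp, intro]: "S \<in> carrier_mat n n"
    and eigen: "\<And>x i. x \<in> carrier_vec n \<Longrightarrow> i < n \<Longrightarrow>
      coord (S *\<^sub>v (B_adjoint B S *\<^sub>v x)) $ i = of_real (d i) * coord x $ i"
    and antimono: "\<And>i j. i \<le> j \<Longrightarrow> j < n \<Longrightarrow> d j \<le> d i"
begin

abbreviation T :: "complex mat" where "T \<equiv> B_adjoint B S"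

lemma T_carrier [simp, intro]: "T \<in> carrier_mat n n"
  by (rule B_adjoint_carrier[OF S_carrier])

lemma S_vec [simp, intro]: "x \<in> carrier_vec n \<Longrightarrow> S *\<^sub>v x \<in> carrier_vec n"
  by (rule mult_mat_vec_carrier[OF S_carrier])

lemma T_vec [simp, intro]: "x \<in> carrier_vec n \<Longrightarrow> T *\<^sub>v x \<in> carrier_vec n"
  by (rule mult_mat_vec_carrier[OF T_carrier])

lemma nrm_T_sq_ip:
  assumes x: "x \<in> carrier_vec n"
  shows "(nrm (T *\<^sub>v x))\<^sup>2 = Re (ip (S *\<^sub>v (T *\<^sub>v x)) x)"
  using ip_adjoint[OF S_carrier T_vec[OF x] x] x by (simp add: nrm_sq_ip)

lemma nrm_T_sq:
  assumes x: "x \<in> carrier_vec n"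
  shows "(nrm (T *\<^sub>v x))\<^sup>2 = (\<Sum>i<n. d i * (cmod (coord x $ i))\<^sup>2)"
proof -
  have "ip (S *\<^sub>v (T *\<^sub>v x)) x = (\<Sum>i<n. of_real (d i * (cmod (coord x $ i))\<^sup>2))"
    using x unfolding ip_coord[OF S_vec[OF T_vec[OF x]] x]
    by (intro sum.cong) (auto simp: eigen complex_norm_square mult.assoc simp del: of_real_power)
  then show ?thesis by (simp add: nrm_T_sq_ip[OF x] del: of_real_mult of_real_power)
qed

text \<open>Each \<open>d i\<close> is the squared norm of \<open>T\<close> applied to the
  corresponding basis vector.\<close>

lemma d_nonneg:
  assumes "i < n" shows "0 \<le> d i"
proof -
  have e: "V *\<^sub>v unit_vec n i \<in> carrier_vec n" by (rule mult_mat_vec_carrier[OF V_carrier]) simp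
  have "(nrm (T *\<^sub>v (V *\<^sub>v unit_vec n i)))\<^sup>2
      = (\<Sum>k<n. d k * (cmod (unit_vec n i $ k))\<^sup>2)"
    by (simp add: nrm_T_sq[OF e])
  also have "\<dots> = (\<Sum>k<n. if k = i then d k else 0)"
    using assms by (intro sum.cong) auto
  also have "\<dots> = d i" using assms by simp
  finally show ?thesis by (metis zero_le_power2)
qed

text \<open>A Rayleigh quotient bound: only the weights \<open>d i\<close> with
  \<open>i \<le> m\<close> contribute, and each of them is at least \<open>d m\<close>.\<close>

lemma nrm_T_leading:
  assumes x: "x \<in> carrier_vec n" and "m < n"
    and lead: "\<And>i. m < i \<Longrightarrow> i < n \<Longrightarrow> coord x $ i = 0"
  shows "d m * (nrm x)\<^sup>2 \<le> (nrm (T *\<^sub>v x))\<^sup>2"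
  unfolding nrm_T_sq[OF x] nrm_sq[OF x] sum_distrib_left
proof (rule sum_mono)
  fix i assume i: "i \<in> {..<n}"
  show "d m * (cmod (coord x $ i))\<^sup>2 \<le> d i * (cmod (coord x $ i))\<^sup>2"
  proof (cases "i \<le> m")
    case True
    then show ?thesis using antimono[OF True \<open>m < n\<close>] by (intro mult_right_mono) auto
  next
    case False
    then show ?thesis using lead i by simp
  qed
qed

text \<open>The coordinates of \<open>S *\<^sub>v (T *\<^sub>v x)\<close> are those of
  \<open>x\<close> scaled by \<open>d i\<close>, so termwise \<open>d m * d i\<close> is compared
  with the square of \<open>d i\<close>. This uses \<open>d_nonneg\<close>.\<close>

lemma nrm_S_T_leading:
  assumes x: "x \<in> carrier_vec n" and "m < n"
    and lead: "\<And>i. m < i \<Longrightarrow> i < n \<Longrightarrow> coord x $ i = 0"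
  shows "d m * (nrm (T *\<^sub>v x))\<^sup>2 \<le> (nrm (S *\<^sub>v (T *\<^sub>v x)))\<^sup>2"
  unfolding nrm_T_sq[OF x] nrm_sq[OF S_vec[OF T_vec[OF x]]] sum_distrib_left
proof (rule sum_mono)
  fix i assume i: "i \<in> {..<n}"
  have "d m * (d i * (cmod (coord x $ i))\<^sup>2) \<le> d i * (d i * (cmod (coord x $ i))\<^sup>2)"
  proof (cases "i \<le> m")
    case True
    then show ?thesis
      using antimono[OF True \<open>m < n\<close>] d_nonneg[of i] i by (intro mult_right_mono) auto
  next
    case False
    then show ?thesis using lead i by simp
  qed
  also have "\<dots> = (cmod (coord (S *\<^sub>v (T *\<^sub>v x)) $ i))\<^sup>2"
    using i x d_nonneg[of i] by (simp add: eigen norm_mult power_mult_distrib power2_eq_square)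
  finally show "d m * (d i * (cmod (coord x $ i))\<^sup>2)
    \<le> (cmod (coord (S *\<^sub>v (T *\<^sub>v x)) $ i))\<^sup>2" .
qed

lemma nrm_T_trailing:
  assumes x: "x \<in> carrier_vec n" and "m < n"
    and trail: "\<And>i. i < m \<Longrightarrow> coord x $ i = 0"
  shows "nrm (T *\<^sub>v x) \<le> sqrt (d m) * nrm x"
proof -
  have "(nrm (T *\<^sub>v x))\<^sup>2 \<le> d m * (nrm x)\<^sup>2"
    unfolding nrm_T_sq[OF x] nrm_sq[OF x] sum_distrib_left
  proof (rule sum_mono)
    fix i assume i: "i \<in> {..<n}"
    show "d i * (cmod (coord x $ i))\<^sup>2 \<le> d m * (cmod (coord x $ i))\<^sup>2"
    proof (cases "m \<le> i")
      case True
      then show ?thesis using antimono[OF True] i by (intro mult_right_mono) auto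
    next
      case False
      then show ?thesis using trail by simp
    qed
  qed
  then have "sqrt ((nrm (T *\<^sub>v x))\<^sup>2) \<le> sqrt (d m * (nrm x)\<^sup>2)" by (rule real_sqrt_le_mono)
  then show ?thesis using x by (simp add: real_sqrt_mult nrm_nonneg)
qed

section \<open>Norm bounds for a coarse correction \<open>Q\<close> before, after and between
  smoothing steps\<close>

context
  fixes Q :: "complex mat" and m :: nat
  assumes Q: "Q \<in> carrier_mat n n" and m: "m < n"
begin

lemma Q_vec: "x \<in> carrier_vec n \<Longrightarrow> Q *\<^sub>v x \<in> carrier_vec n"
  by (rule mult_mat_vec_carrier[OF Q])

text \<open>The \<open>m\<close> equations \<open>F *\<^sub>v x = 0\<^sub>v m\<close> force
  \<open>x\<close> to be fixed by \<open>Q\<close>. Such an \<open>x\<close> exists in the span of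
  the first \<open>m + 1\<close> basis vectors, and there \<open>T * Q\<close> acts as
  \<open>T\<close>, which shrinks squared norms by no factor below \<open>d m\<close>.\<close>

lemma norm_post_ge:
  assumes F: "F \<in> carrier_mat m n"
    and fixed: "\<And>x. x \<in> carrier_vec n \<Longrightarrow> F *\<^sub>v x = 0\<^sub>v m \<Longrightarrow> Q *\<^sub>v x = x"
  shows "d m \<le> (B_norm B (T * Q))\<^sup>2"
proof -
  obtain x where x: "x \<in> carrier_vec n" "x \<noteq> 0\<^sub>v n" "F *\<^sub>v x = 0\<^sub>v m"
    and lead: "\<And>i. m < i \<Longrightarrow> i < n \<Longrightarrow> coord x $ i = 0"
    using exists_vec_in_leading_span[OF F m] by blast
  have TQ: "T * Q \<in> carrier_mat n n" using T_carrier Q by (rule mult_carrier_mat)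
  have "(T * Q) *\<^sub>v x = T *\<^sub>v x"
    using fixed[OF x(1,3)] assoc_mult_mat_vec[OF T_carrier Q x(1)] by simp
  then have "nrm (T *\<^sub>v x) \<le> B_norm B (T * Q) * nrm x"
    using nrm_mult_le[OF TQ x(1)] by simp
  then have "(nrm (T *\<^sub>v x))\<^sup>2 \<le> (B_norm B (T * Q) * nrm x)\<^sup>2"
    using x by (intro power_mono nrm_nonneg) auto
  with nrm_T_leading[OF x(1) m lead]
  have "d m * (nrm x)\<^sup>2 \<le> (B_norm B (T * Q))\<^sup>2 * (nrm x)\<^sup>2"
    by (simp add: power_mult_distrib)
  then show ?thesis using nrm_pos[OF x(1,2)] by simp
qed

text \<open>Dual to \<open>norm_post_ge\<close>: \<open>y\<close> is now fixed by the
  \<open>B\<close>-adjoint of \<open>Q\<close>, which the hypothesis expresses weakly through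
  \<open>ip\<close>. The test vector is \<open>T *\<^sub>v y\<close>, because its squared norm
  equals the product of \<open>Q S T y\<close> with \<open>y\<close>, to which Cauchy-Schwarz
  applies.\<close>

lemma norm_pre_ge:
  assumes G: "G \<in> carrier_mat m n"
    and fixed: "\<And>y z. y \<in> carrier_vec n \<Longrightarrow> G *\<^sub>v y = 0\<^sub>v m \<Longrightarrow> z \<in> carrier_vec n \<Longrightarrow>
      ip (Q *\<^sub>v z) y = ip z y"
  shows "d m \<le> (B_norm B (Q * S))\<^sup>2"
proof -
  obtain y where y: "y \<in> carrier_vec n" "y \<noteq> 0\<^sub>v n" "G *\<^sub>v y = 0\<^sub>v m"
    and lead: "\<And>i. m < i \<Longrightarrow> i < n \<Longrightarrow> coord y $ i = 0"
    using exists_vec_in_leading_span[OF G m] by blast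
  have QS: "Q * S \<in> carrier_mat n n" using Q S_carrier by (rule mult_carrier_mat)
  let ?x = "T *\<^sub>v y" and ?K = "B_norm B (Q * S)"
  have x: "?x \<in> carrier_vec n" using y by simp
  have K: "0 \<le> ?K" using B_norm_nonneg[OF QS] m by simp
  have "(nrm ?x)\<^sup>2 = Re (ip (S *\<^sub>v ?x) y)" by (rule nrm_T_sq_ip[OF y(1)])
  also have "\<dots> = Re (ip ((Q * S) *\<^sub>v ?x) y)"
    using fixed[OF y(1,3)] assoc_mult_mat_vec[OF Q S_carrier x] x by simp
  also have "\<dots> \<le> nrm ((Q * S) *\<^sub>v ?x) * nrm y"
    using QS x y by (intro cauchy_schwarz mult_mat_vec_carrier) auto
  also have "\<dots> \<le> ?K * nrm ?x * nrm y"
    using nrm_mult_le[OF QS x] nrm_nonneg[OF y(1)] by (intro mult_right_mono)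
  finally have "nrm ?x * nrm ?x \<le> (?K * nrm y) * nrm ?x"
    by (simp add: power2_eq_square ac_simps)
  \<comment> \<open>One factor \<open>nrm ?x\<close> is cancelled; if it is zero, the claim holds
    because the right-hand side is nonnegative.\<close>
  then have "nrm ?x \<le> ?K * nrm y"
    using nrm_nonneg[OF x] K nrm_nonneg[OF y(1)]
    by (cases "nrm ?x = 0") (auto simp: mult_le_cancel_right)
  then have "(nrm ?x)\<^sup>2 \<le> (?K * nrm y)\<^sup>2"
    using nrm_nonneg[OF x] by (intro power_mono)
  with nrm_T_leading[OF y(1) m lead] have "d m * (nrm y)\<^sup>2 \<le> ?K\<^sup>2 * (nrm y)\<^sup>2"
    by (simp add: power_mult_distrib)
  then show ?thesis using nrm_pos[OF y(1,2)] by simp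
qed

text \<open>The test vector is \<open>T w\<close> with \<open>S T w\<close> fixed by \<open>Q\<close>: then
  \<open>\<langle>T Q S T w, T w\<rangle> = \<parallel>S T w\<parallel>\<^sup>2\<close>, and the right-hand side dominates \<open>d m \<parallel>T w\<parallel>\<^sup>2\<close>.\<close>

lemma norm_both_ge:
  assumes F: "F \<in> carrier_mat m n"
    and fixed: "\<And>x. x \<in> carrier_vec n \<Longrightarrow> F *\<^sub>v x = 0\<^sub>v m \<Longrightarrow> Q *\<^sub>v x = x"
  shows "(d m)\<^sup>2 \<le> (B_norm B (T * Q * S))\<^sup>2"
proof -
  \<comment> \<open>Pulling the equations of \<open>F\<close> back along \<open>S * T\<close> still
    leaves only \<open>m\<close> equations for \<open>w\<close>, and they make
    \<open>S *\<^sub>v (T *\<^sub>v w)\<close> fixed by \<open>Q\<close>.\<close>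
  have FST: "F * S * T \<in> carrier_mat m n" using F S_carrier T_carrier by (metis mult_carrier_mat)
  obtain w where w: "w \<in> carrier_vec n" "w \<noteq> 0\<^sub>v n" "(F * S * T) *\<^sub>v w = 0\<^sub>v m"
    and lead: "\<And>i. m < i \<Longrightarrow> i < n \<Longrightarrow> coord w $ i = 0"
    using exists_vec_in_leading_span[OF FST m] by blast
  let ?x = "T *\<^sub>v w" and ?E = "T * Q * S"
  let ?a = "S *\<^sub>v ?x"
  have TQ: "T * Q \<in> carrier_mat n n" using T_carrier Q by (rule mult_carrier_mat)
  then have E: "?E \<in> carrier_mat n n" using S_carrier by (rule mult_carrier_mat)
  have x: "?x \<in> carrier_vec n" and a: "?a \<in> carrier_vec n" using w by auto
  have FS: "F * S \<in> carrier_mat m n" using F S_carrier by (rule mult_carrier_mat)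
  have "F *\<^sub>v ?a = 0\<^sub>v m"
    using w assoc_mult_mat_vec[OF FS T_carrier w(1)] assoc_mult_mat_vec[OF F S_carrier x] by simp
  then have Qa: "Q *\<^sub>v ?a = ?a" by (rule fixed[OF a])
  have Ex: "?E *\<^sub>v ?x = T *\<^sub>v ?a"
    using assoc_mult_mat_vec[OF TQ S_carrier x] assoc_mult_mat_vec[OF T_carrier Q a] Qa by simp
  have "(nrm ?a)\<^sup>2 = Re (ip ?a ?a)" by (rule nrm_sq_ip[OF a])
  also have "\<dots> = Re (ip ?x (T *\<^sub>v ?a))" using ip_adjoint[OF S_carrier x a] by simp
  also have "\<dots> \<le> nrm ?x * nrm (?E *\<^sub>v ?x)" unfolding Ex using x a by (intro cauchy_schwarz) auto
  also have "\<dots> \<le> nrm ?x * (B_norm B ?E * nrm ?x)"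
    using nrm_mult_le[OF E x] nrm_nonneg[OF x] by (intro mult_left_mono)
  finally have upper: "d m * (nrm ?x)\<^sup>2 \<le> B_norm B ?E * (nrm ?x)\<^sup>2"
    using nrm_S_T_leading[OF w(1) m lead] by (simp add: power2_eq_square ac_simps)
  have "d m \<le> B_norm B ?E"
  \<comment> \<open>The test vector may vanish. In that case the leading-span bound for the nonzero
    \<open>w\<close> forces \<open>d m \<le> 0\<close>, so nonnegativity of the norm is
    enough.\<close>
  proof (cases "nrm ?x = 0")
    case True
    then have "d m * (nrm w)\<^sup>2 \<le> 0" using nrm_T_leading[OF w(1) m lead] by simp
    then have "d m \<le> 0" using nrm_pos[OF w(1,2)] by (simp add: mult_le_0_iff)
    then show ?thesis using B_norm_nonneg[OF E] m by simp
  next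
    case False
    then show ?thesis using upper nrm_nonneg[OF x] by (simp add: mult_le_cancel_right)
  qed
  then show ?thesis using d_nonneg[OF m] by (intro power_mono)
qed

section \<open>Matching upper bounds when \<open>Q\<close> discards the first \<open>m\<close>
  coordinates\<close>

context
  assumes trunc: "\<And>x i. x \<in> carrier_vec n \<Longrightarrow> i < n \<Longrightarrow>
    coord (Q *\<^sub>v x) $ i = (if i < m then 0 else coord x $ i)"
begin

lemma nrm_trunc_le:
  assumes x: "x \<in> carrier_vec n"
  shows "nrm (Q *\<^sub>v x) \<le> nrm x"
  unfolding nrm_coord[OF x] nrm_coord[OF Q_vec[OF x]]
  using trunc[OF x] by (intro L2_set_mono) auto

text \<open>The right-hand side keeps \<open>nrm (Q *\<^sub>v x)\<close> instead of weakening it to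
  \<open>nrm x\<close>: this allows a cancellation in \<open>nrm_trunc_S_le\<close> and a second
  factor \<open>sqrt (d m)\<close> in \<open>norm_both_le\<close>.\<close>

lemma nrm_T_trunc_le:
  assumes x: "x \<in> carrier_vec n"
  shows "nrm (T *\<^sub>v (Q *\<^sub>v x)) \<le> sqrt (d m) * nrm (Q *\<^sub>v x)"
  using trunc[OF x] m by (intro nrm_T_trailing Q_vec x) auto

text \<open>Truncation is a \<open>B\<close>-orthogonal projection, so the squared norm of
  \<open>z = Q S x\<close> is the product of \<open>S x\<close> with \<open>z\<close>, hence of
  \<open>x\<close> with \<open>T z\<close>. Cauchy-Schwarz and the bound for \<open>T\<close> on
  truncated vectors then leave one factor \<open>nrm z\<close> to cancel.\<close>

lemma nrm_trunc_S_le: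
  assumes x: "x \<in> carrier_vec n"
  shows "nrm (Q *\<^sub>v (S *\<^sub>v x)) \<le> sqrt (d m) * nrm x"
proof -
  let ?z = "Q *\<^sub>v (S *\<^sub>v x)"
  have z: "?z \<in> carrier_vec n" using x by (intro Q_vec) auto
  have "ip ?z ?z = ip (S *\<^sub>v x) ?z"
    unfolding ip_coord[OF z z] ip_coord[OF S_vec[OF x] z]
    using x by (intro sum.cong) (auto simp: trunc)
  then have "(nrm ?z)\<^sup>2 = Re (ip x (T *\<^sub>v ?z))"
    using ip_adjoint[OF S_carrier x z] nrm_sq_ip[OF z] by simp
  also have "\<dots> \<le> nrm x * nrm (T *\<^sub>v ?z)"
    using x z by (intro cauchy_schwarz) auto
  also have "\<dots> \<le> nrm x * (sqrt (d m) * nrm ?z)"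
    using x by (intro mult_left_mono nrm_T_trunc_le nrm_nonneg) auto
  finally have "nrm ?z * nrm ?z \<le> (sqrt (d m) * nrm x) * nrm ?z"
    by (simp add: power2_eq_square ac_simps)
  then show ?thesis
    using nrm_nonneg[OF z] nrm_nonneg[OF x] d_nonneg[OF m]
    by (cases "nrm ?z = 0") (auto simp: mult_le_cancel_right)
qed

lemma norm_post_le: "(B_norm B (T * Q))\<^sup>2 \<le> d m"
proof -
  have TQ: "T * Q \<in> carrier_mat n n" using T_carrier Q by (rule mult_carrier_mat)
  have "B_norm B (T * Q) \<le> sqrt (d m)"
  proof (rule B_norm_le[OF TQ])
    fix x :: "complex vec" assume x: "x \<in> carrier_vec n"
    have "nrm (T *\<^sub>v (Q *\<^sub>v x)) \<le> sqrt (d m) * nrm (Q *\<^sub>v x)" by (rule nrm_T_trunc_le[OF x])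
    also have "\<dots> \<le> sqrt (d m) * nrm x"
      using nrm_trunc_le[OF x] d_nonneg[OF m] by (intro mult_left_mono) auto
    finally show "nrm ((T * Q) *\<^sub>v x) \<le> sqrt (d m) * nrm x"
      using assoc_mult_mat_vec[OF T_carrier Q x] by simp
  qed (use m in simp)
  then have "(B_norm B (T * Q))\<^sup>2 \<le> (sqrt (d m))\<^sup>2"
    using B_norm_nonneg[OF TQ] m by (intro power_mono) auto
  then show ?thesis using d_nonneg[OF m] by simp
qed

lemma norm_pre_le: "(B_norm B (Q * S))\<^sup>2 \<le> d m"
proof -
  have QS: "Q * S \<in> carrier_mat n n" using Q S_carrier by (rule mult_carrier_mat)
  have "B_norm B (Q * S) \<le> sqrt (d m)"
    using m nrm_trunc_S_le assoc_mult_mat_vec[OF Q S_carrier] by (intro B_norm_le[OF QS]) auto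
  then have "(B_norm B (Q * S))\<^sup>2 \<le> (sqrt (d m))\<^sup>2"
    using B_norm_nonneg[OF QS] m by (intro power_mono) auto
  then show ?thesis using d_nonneg[OF m] by simp
qed

lemma norm_both_le: "(B_norm B (T * Q * S))\<^sup>2 \<le> (d m)\<^sup>2"
proof -
  have TQ: "T * Q \<in> carrier_mat n n" using T_carrier Q by (rule mult_carrier_mat)
  then have E: "T * Q * S \<in> carrier_mat n n" using S_carrier by (rule mult_carrier_mat)
  have "B_norm B (T * Q * S) \<le> d m"
  proof (rule B_norm_le[OF E])
    fix x :: "complex vec" assume x: "x \<in> carrier_vec n"
    have Sx: "S *\<^sub>v x \<in> carrier_vec n" using x by simp
    have "nrm (T *\<^sub>v (Q *\<^sub>v (S *\<^sub>v x))) \<le> sqrt (d m) * nrm (Q *\<^sub>v (S *\<^sub>v x))"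
      by (rule nrm_T_trunc_le[OF Sx])
    also have "\<dots> \<le> sqrt (d m) * (sqrt (d m) * nrm x)"
      using nrm_trunc_S_le[OF x] d_nonneg[OF m] by (intro mult_left_mono) auto
    also have "\<dots> = d m * nrm x" using d_nonneg[OF m] by simp
    finally show "nrm ((T * Q * S) *\<^sub>v x) \<le> d m * nrm x"
      using assoc_mult_mat_vec[OF TQ S_carrier x] assoc_mult_mat_vec[OF T_carrier Q Sx] by simp
  qed (use m in simp)
  then show ?thesis using B_norm_nonneg[OF E] m by (intro power_mono) auto
qed

end

end

end

subsection \<open>Coarse-space projections\<close>

lemma coarse_proj_carrier:
  assumes "A \<in> carrier_mat n n" "P \<in> carrier_mat n m" "R \<in> carrier_mat n m"
    and "invertible_mat (mat_adjoint R * A * P)"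
  shows "coarse_proj A P R \<in> carrier_mat n n"
proof -
  have RA: "mat_adjoint R * A \<in> carrier_mat m n" using assms(3,1) by (rule mat_adjoint_mult_carrier)
  then have "mat_adjoint R * A * P \<in> carrier_mat m m" using assms(2) by (rule mult_carrier_mat)
  from mat_inv_inverts(1)[OF this assms(4)] show ?thesis
    unfolding coarse_proj_def using RA assms by (metis mult_carrier_mat)
qed

text \<open>Applying the factors one at a time exhibits the image as \<open>P\<close> applied to an
  explicit coarse vector, so it lies in the range of \<open>P\<close>.\<close>

lemma coarse_proj_vec:
  assumes "A \<in> carrier_mat n n" "P \<in> carrier_mat n m" "R \<in> carrier_mat n m"
    and "invertible_mat (mat_adjoint R * A * P)" and x: "x \<in> carrier_vec n"
  shows "coarse_proj A P R *\<^sub>v x =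
      P *\<^sub>v (mat_inv (mat_adjoint R * A * P) *\<^sub>v ((mat_adjoint R * A) *\<^sub>v x))"
    and "mat_inv (mat_adjoint R * A * P) *\<^sub>v ((mat_adjoint R * A) *\<^sub>v x) \<in> carrier_vec m"
proof -
  have RA: "mat_adjoint R * A \<in> carrier_mat m n" using assms(3,1) by (rule mat_adjoint_mult_carrier)
  then have "mat_adjoint R * A * P \<in> carrier_mat m m" using assms(2) by (rule mult_carrier_mat)
  note G = mat_inv_inverts(1)[OF this assms(4)]
  have PG: "P * mat_inv (mat_adjoint R * A * P) \<in> carrier_mat n m"
    using assms G by (intro mult_carrier_mat)
  have RAx: "(mat_adjoint R * A) *\<^sub>v x \<in> carrier_vec m" using RA x by (rule mult_mat_vec_carrier)
  show "mat_inv (mat_adjoint R * A * P) *\<^sub>v ((mat_adjoint R * A) *\<^sub>v x) \<in> carrier_vec m"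
    using G RAx by (rule mult_mat_vec_carrier)
  show "coarse_proj A P R *\<^sub>v x =
      P *\<^sub>v (mat_inv (mat_adjoint R * A * P) *\<^sub>v ((mat_adjoint R * A) *\<^sub>v x))"
    unfolding coarse_proj_def
    using assoc_mult_mat_vec[OF PG RA x] assoc_mult_mat_vec[OF assms(2) G RAx] by simp
qed

text \<open>On the range of \<open>P\<close> the middle inverse cancels against
  \<open>mat_adjoint R * A * P\<close>. Together with \<open>coarse_proj_kernel\<close> this
  determines the projection on sums of such vectors and kernel vectors.\<close>

lemma coarse_proj_range:
  assumes "A \<in> carrier_mat n n" "P \<in> carrier_mat n m" "R \<in> carrier_mat n m"
    and "invertible_mat (mat_adjoint R * A * P)" and u: "u \<in> carrier_vec m"
  shows "coarse_proj A P R *\<^sub>v (P *\<^sub>v u) = P *\<^sub>v u"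
proof -
  let ?RAP = "mat_adjoint R * A * P"
  have Pu: "P *\<^sub>v u \<in> carrier_vec n" using assms(2) u by (rule mult_mat_vec_carrier)
  have RA: "mat_adjoint R * A \<in> carrier_mat m n" using assms(3,1) by (rule mat_adjoint_mult_carrier)
  then have RAP: "?RAP \<in> carrier_mat m m" using assms(2) by (rule mult_carrier_mat)
  note G = mat_inv_inverts[OF this assms(4)]
  have "mat_inv ?RAP *\<^sub>v ((mat_adjoint R * A) *\<^sub>v (P *\<^sub>v u)) = mat_inv ?RAP *\<^sub>v (?RAP *\<^sub>v u)"
    using assoc_mult_mat_vec[OF RA assms(2) u] by simp
  also have "\<dots> = u" using assoc_mult_mat_vec[OF G(1) RAP u] G(3) u by simp
  finally show ?thesis by (simp add: coarse_proj_vec(1)[OF assms(1-4) Pu])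
qed

lemma coarse_proj_kernel:
  assumes "A \<in> carrier_mat n n" "P \<in> carrier_mat n m" "R \<in> carrier_mat n m"
    and "invertible_mat (mat_adjoint R * A * P)" and x: "x \<in> carrier_vec n"
    and "(mat_adjoint R * A) *\<^sub>v x = 0\<^sub>v m"
  shows "coarse_proj A P R *\<^sub>v x = 0\<^sub>v n"
proof -
  have RA: "mat_adjoint R * A \<in> carrier_mat m n" using assms(3,1) by (rule mat_adjoint_mult_carrier)
  then have "mat_adjoint R * A * P \<in> carrier_mat m m" using assms(2) by (rule mult_carrier_mat)
  note G = mat_inv_inverts(1)[OF this assms(4)]
  show ?thesis
    using assms(6) mult_mat_zero_vec[OF G] mult_mat_zero_vec[OF assms(2)]
    by (simp add: coarse_proj_vec(1)[OF assms(1-5)])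
qed

lemma one_minus_mult_vec:
  fixes C :: "complex mat"
  shows "C \<in> carrier_mat n n \<Longrightarrow> x \<in> carrier_vec n \<Longrightarrow> (1\<^sub>m n - C) *\<^sub>v x = x - C *\<^sub>v x"
  by (subst minus_mult_distrib_mat_vec[of _ n n]) auto

section \<open>The smoother identity and coarse projections in eigenvector coordinates\<close>

context B_unitary_basis
begin

lemma B_adjoint_one_minus:
  assumes N: "N \<in> carrier_mat n n"
  shows "B_adjoint B (1\<^sub>m n - N) = 1\<^sub>m n - B_adjoint B N"
proof -
  have NH: "mat_adjoint N \<in> carrier_mat n n" using N by simp
  have BN: "mat_inv B * mat_adjoint N \<in> carrier_mat n n" using inv_B(1) NH by (rule mult_carrier_mat)
  have "mat_inv B * (1\<^sub>m n - mat_adjoint N) = mat_inv B - mat_inv B * mat_adjoint N"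
    using mult_minus_distrib_mat[OF inv_B(1) one_carrier_mat NH] inv_B(1) by simp
  then show ?thesis
    unfolding B_adjoint_def mat_adjoint_minus[OF one_carrier_mat N]
    using minus_mult_distrib_mat[OF inv_B(1) BN B_carrier] inv_B(3) by simp
qed

text \<open>With \<open>C\<close> the \<open>B\<close>-adjoint of \<open>N\<close>, the product
  \<open>Mhat_inv A M B * B\<close> expands to \<open>N + C - N * C\<close>, and subtracting this
  from the identity factors as \<open>(1 - N) * (1 - C)\<close>. The second factor is the adjoint of
  the first by \<open>B_adjoint_one_minus\<close>.\<close>

lemma one_minus_Mhat_inv:
  assumes A: "A \<in> carrier_mat n n" and M: "mat_inv M \<in> carrier_mat n n"
  defines "N \<equiv> mat_inv M * A"
  shows "1\<^sub>m n - Mhat_inv A M B * B = (1\<^sub>m n - N) * B_adjoint B (1\<^sub>m n - N)"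
proof -
  have N: "N \<in> carrier_mat n n" unfolding N_def using M A by (rule mult_carrier_mat)
  have NH: "mat_adjoint N \<in> carrier_mat n n" using N by simp
  have NB: "N * mat_inv B \<in> carrier_mat n n" using N inv_B(1) by (rule mult_carrier_mat)
  have BN: "mat_inv B * mat_adjoint N \<in> carrier_mat n n" using inv_B(1) NH by (rule mult_carrier_mat)
  have NBN: "N * mat_inv B * mat_adjoint N \<in> carrier_mat n n" using NB NH by (rule mult_carrier_mat)
  have C: "B_adjoint B N \<in> carrier_mat n n" using N by (rule B_adjoint_carrier)
  have NC: "N * B_adjoint B N \<in> carrier_mat n n" using N C by (rule mult_carrier_mat)
  have NH_eq: "mat_adjoint N = mat_adjoint A * mat_adjoint (mat_inv M)"
    unfolding N_def by (rule mat_adjoint_mult[OF M A])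
  have AH: "mat_adjoint A \<in> carrier_mat n n" and MH: "mat_adjoint (mat_inv M) \<in> carrier_mat n n"
    using A M by auto
  have "Mhat_inv A M B
      = N * mat_inv B + mat_inv B * mat_adjoint N - N * mat_inv B * mat_adjoint N"
    unfolding Mhat_inv_def N_def[symmetric] NH_eq
    using assoc_mult_mat[OF inv_B(1) AH MH] assoc_mult_mat[OF NB AH MH] by simp
  also have "\<dots> * B = N * mat_inv B * B + mat_inv B * mat_adjoint N * B
      - N * mat_inv B * mat_adjoint N * B"
    using minus_mult_distrib_mat[OF add_carrier_mat[OF BN] NBN B_carrier]
      add_mult_distrib_mat[OF NB BN B_carrier] by simp
  also have "N * mat_inv B * B = N"
    using assoc_mult_mat[OF N inv_B(1) B_carrier] inv_B(3) N by simp
  also have "N * mat_inv B * mat_adjoint N * B = N * B_adjoint B N"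
    unfolding B_adjoint_def
    using assoc_mult_mat[OF N inv_B(1) NH] assoc_mult_mat[OF N BN B_carrier] by simp
  finally have Mhat: "Mhat_inv A M B * B = N + B_adjoint B N - N * B_adjoint B N"
    unfolding B_adjoint_def .
  have "(1\<^sub>m n - N) * (1\<^sub>m n - B_adjoint B N)
      = (1\<^sub>m n - B_adjoint B N) - (N - N * B_adjoint B N)"
    using minus_mult_distrib_mat[OF one_carrier_mat N, of "1\<^sub>m n - B_adjoint B N" n]
      mult_minus_distrib_mat[OF N one_carrier_mat C] N C
    by (simp add: minus_carrier_mat)
  also have "\<dots> = 1\<^sub>m n - (N + B_adjoint B N - N * B_adjoint B N)"
    using N C NC carrier_matD[OF C] carrier_matD[OF NC] by (intro eq_matI) auto
  finally show ?thesis unfolding Mhat B_adjoint_one_minus[OF N] by simp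
qed

lemma coord_diagonalized:
  assumes C: "C = V * mat_diag n f * mat_inv V" and x: "x \<in> carrier_vec n" and i: "i < n"
  shows "coord (C *\<^sub>v x) $ i = f i * coord x $ i"
proof -
  have VD: "V * mat_diag n f \<in> carrier_mat n n" by (rule mult_carrier_mat[OF V_carrier]) simp
  have "C *\<^sub>v x = (V * mat_diag n f) *\<^sub>v coord x"
    unfolding C mat_inv_V coord_def by (rule assoc_mult_mat_vec[OF VD VB_carrier x])
  also have "\<dots> = V *\<^sub>v (mat_diag n f *\<^sub>v coord x)"
    by (rule assoc_mult_mat_vec[OF V_carrier _ coord_carrier]) simp
  finally have "coord (C *\<^sub>v x) = mat_diag n f *\<^sub>v coord x"
    using mult_mat_vec_carrier[OF mat_diag_dim coord_carrier] by simp
  then have "coord (C *\<^sub>v x) $ i = (\<Sum>j<n. (if i = j then f j else 0) * coord x $ j)"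
    using i by (simp add: scalar_prod_def mat_diag_def atLeast0LessThan)
  also have "\<dots> = (\<Sum>j<n. if j = i then f j * coord x $ j else 0)"
    by (intro sum.cong) auto
  finally show ?thesis using i by simp
qed

text \<open>The correction to \<open>z\<close> lies in the range of \<open>P\<close>, while the
  equation for \<open>y\<close> says that \<open>y\<close> is \<open>B\<close>-orthogonal to that
  range. This is the weak fixed-point condition of \<open>norm_pre_ge\<close>.\<close>

lemma coarse_proj_adjoint_fixed:
  assumes "A \<in> carrier_mat n n" "P \<in> carrier_mat n m" "R \<in> carrier_mat n m"
    and "invertible_mat (mat_adjoint R * A * P)"
    and y: "y \<in> carrier_vec n" "(mat_adjoint P * B) *\<^sub>v y = 0\<^sub>v m" and z: "z \<in> carrier_vec n"
  shows "ip ((1\<^sub>m n - coarse_proj A P R) *\<^sub>v z) y = ip z y"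
proof -
  let ?\<Pi> = "coarse_proj A P R"
  have Pi: "?\<Pi> \<in> carrier_mat n n" by (rule coarse_proj_carrier[OF assms(1-4)])
  have Pz: "?\<Pi> *\<^sub>v z \<in> carrier_vec n" using Pi z by (rule mult_mat_vec_carrier)
  obtain u where u: "u \<in> carrier_vec m" "?\<Pi> *\<^sub>v z = P *\<^sub>v u"
    using coarse_proj_vec[OF assms(1-4) z] by blast
  have PH: "mat_adjoint P \<in> carrier_mat m n" using assms(2) by simp
  have By: "B *\<^sub>v y \<in> carrier_vec n" using y(1) by (rule mult_mat_vec_carrier[OF B_carrier])
  have "ip (?\<Pi> *\<^sub>v z) y = (P *\<^sub>v u) \<bullet>c (B *\<^sub>v y)"
    unfolding ip_def using cscalar_prod_mat_adjoint[OF B_carrier Pz y(1)] u by simp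
  also have "\<dots> = u \<bullet>c ((mat_adjoint P * B) *\<^sub>v y)"
    using cscalar_prod_mat_adjoint[OF assms(2) u(1) By] assoc_mult_mat_vec[OF PH B_carrier y(1)]
    by simp
  also have "\<dots> = 0" using y u by simp
  finally have "(\<Sum>i<n. coord (?\<Pi> *\<^sub>v z) $ i * cnj (coord y $ i)) = 0"
    by (simp add: ip_coord[OF Pz y(1)])
  moreover have "ip (z - ?\<Pi> *\<^sub>v z) y = (\<Sum>i<n. coord z $ i * cnj (coord y $ i))
      - (\<Sum>i<n. coord (?\<Pi> *\<^sub>v z) $ i * cnj (coord y $ i))"
    using z Pz y(1)
    by (subst ip_coord) (auto simp: coord_minus sum_subtractf[symmetric] left_diff_distrib
        intro!: sum.cong)
  ultimately show ?thesis
    using one_minus_mult_vec[OF Pi z] ip_coord[OF z y(1)] by simp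
qed

text \<open>Nonsingularity for the optimal pair is derived from the range and kernel conditions. A
  kernel vector \<open>x\<close> gives \<open>P *\<^sub>v x\<close> in both the leading and the
  trailing span, hence \<open>P *\<^sub>v x = 0\<^sub>v n\<close>; injectivity of \<open>P\<close>
  remains, and it follows because its range is the full \<open>m\<close>-dimensional leading
  span.\<close>

lemma hat_coarse_nonsingular:
  assumes A: "A \<in> carrier_mat n n" and P: "P \<in> carrier_mat n m" and R: "R \<in> carrier_mat n m"
    and m: "m \<le> n"
    and range: "mat_range P = mat_range (cols_between V 0 m)"
    and ker: "mat_kernel (mat_adjoint R * A) = mat_range (cols_between V m n)"
  shows "invertible_mat (mat_adjoint R * A * P)"
proof (rule invertible_matI)
  have RA: "mat_adjoint R * A \<in> carrier_mat m n" using R A by (rule mat_adjoint_mult_carrier)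
  then show "mat_adjoint R * A * P \<in> carrier_mat m m" using P by (rule mult_carrier_mat)
  have range': "(\<lambda>u. P *\<^sub>v u) ` carrier_vec m =
      {x \<in> carrier_vec n. \<forall>k<n. k \<notin> {0..<m} \<longrightarrow> coord x $ k = 0}"
    using range m mat_range_cols_between[of 0 m] P unfolding mat_range_def by auto
  fix x :: "complex vec"
  assume x: "x \<in> carrier_vec m" and "(mat_adjoint R * A * P) *\<^sub>v x = 0\<^sub>v m"
  then have "P *\<^sub>v x \<in> mat_kernel (mat_adjoint R * A)"
    using RA P mult_mat_vec_carrier[OF P x] assoc_mult_mat_vec[OF RA P x]
    by (intro mat_kernelI) auto
  then have "\<forall>k<n. k \<notin> {m..<n} \<longrightarrow> coord (P *\<^sub>v x) $ k = 0"
    unfolding ker using mat_range_cols_between[of m n] m by auto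
  moreover have "\<forall>k<n. k \<notin> {0..<m} \<longrightarrow> coord (P *\<^sub>v x) $ k = 0"
    using x range' by blast
  ultimately have "coord (P *\<^sub>v x) $ k = 0" if "k < n" for k
    using that by (metis atLeastLessThan_iff not_le zero_le)
  then have Px: "P *\<^sub>v x = 0\<^sub>v n"
    using mult_mat_vec_carrier[OF P x] by (intro coord_eqI) auto
  \<comment> \<open>\<open>W\<close> reads off the first \<open>m\<close> coordinates. It maps the
    leading span onto the whole coarse space, so the square matrix \<open>W * P\<close> is
    surjective and therefore injective.\<close>
  define W where "W = mat m n (\<lambda>(i, j). (mat_adjoint V * B) $$ (i, j))"
  have W: "W \<in> carrier_mat m n" unfolding W_def by simp
  have W_vec: "W *\<^sub>v z = vec m (\<lambda>i. coord z $ i)" for z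
  proof (rule eq_vecI)
    fix i assume "i < dim_vec (vec m (\<lambda>i. coord z $ i))"
    then have i: "i < m" by simp
    have "row W i = row (mat_adjoint V * B) i"
      using i m carrier_matD[OF B_carrier] carrier_matD[OF V_carrier]
      by (intro eq_vecI) (auto simp: W_def)
    then show "(W *\<^sub>v z) $ i = vec m (\<lambda>i. coord z $ i) $ i"
      using i m W carrier_matD[OF V_carrier] by (simp add: coord_def)
  qed (use W in simp)
  have WP: "W * P \<in> carrier_mat m m" using W P by (rule mult_carrier_mat)
  show "x = 0\<^sub>v m"
  proof (rule surj_square_mat_inj[OF WP _ x])
    show "(W * P) *\<^sub>v x = 0\<^sub>v m"
      using assoc_mult_mat_vec[OF W P x] Px mult_mat_zero_vec[OF W] by simp
    fix y :: "complex vec" assume y: "y \<in> carrier_vec m"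
    let ?c = "vec n (\<lambda>k. if k < m then y $ k else 0)"
    have c: "?c \<in> carrier_vec n" by simp
    have "V *\<^sub>v ?c \<in> (\<lambda>u. P *\<^sub>v u) ` carrier_vec m"
      unfolding range' using mult_mat_vec_carrier[OF V_carrier c] c by auto
    then obtain u where u: "u \<in> carrier_vec m" "P *\<^sub>v u = V *\<^sub>v ?c" by force
    have "(W * P) *\<^sub>v u = y"
      using assoc_mult_mat_vec[OF W P u(1)] u(2) W_vec c y m by (intro eq_vecI) auto
    then show "\<exists>u \<in> carrier_vec m. (W * P) *\<^sub>v u = y" using u by blast
  qed
qed

text \<open>The vector splits into a leading part, which the coarse projection fixes, and a trailing
  part, which it annihilates. The complementary projection therefore returns the trailing
  part.\<close>

lemma hat_coarse_truncates:
  assumes A: "A \<in> carrier_mat n n" and P: "P \<in> carrier_mat n m" and R: "R \<in> carrier_mat n m"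
    and m: "m \<le> n"
    and range: "mat_range P = mat_range (cols_between V 0 m)"
    and ker: "mat_kernel (mat_adjoint R * A) = mat_range (cols_between V m n)"
    and x: "x \<in> carrier_vec n" and i: "i < n"
  shows "coord ((1\<^sub>m n - coarse_proj A P R) *\<^sub>v x) $ i = (if i < m then 0 else coord x $ i)"
proof -
  note ns = hat_coarse_nonsingular[OF A P R m range ker]
  let ?\<Pi> = "coarse_proj A P R"
  have Pi: "?\<Pi> \<in> carrier_mat n n" by (rule coarse_proj_carrier[OF A P R ns])
  have RA: "mat_adjoint R * A \<in> carrier_mat m n" using R A by (rule mat_adjoint_mult_carrier)
  define a where "a = V *\<^sub>v vec n (\<lambda>k. if k < m then coord x $ k else 0)"
  define b where "b = V *\<^sub>v vec n (\<lambda>k. if k < m then 0 else coord x $ k)"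
  have a: "a \<in> carrier_vec n" and b: "b \<in> carrier_vec n"
    unfolding a_def b_def by (auto intro: mult_mat_vec_carrier[OF V_carrier])
  have ca: "coord a = vec n (\<lambda>k. if k < m then coord x $ k else 0)"
    and cb: "coord b = vec n (\<lambda>k. if k < m then 0 else coord x $ k)"
    unfolding a_def b_def by simp_all
  have xab: "x = a + b"
    using x a b by (intro coord_eqI) (auto simp: coord_add ca cb)
  have "a \<in> mat_range P"
    unfolding range using mat_range_cols_between[of 0 m] m a ca by auto
  then have "?\<Pi> *\<^sub>v a = a"
    unfolding mat_range_def using P coarse_proj_range[OF A P R ns] by auto
  moreover have "b \<in> mat_kernel (mat_adjoint R * A)"
    unfolding ker using mat_range_cols_between[of m n] m b cb by auto
  then have "?\<Pi> *\<^sub>v b = 0\<^sub>v n"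
    using mat_kernelD[OF RA] by (intro coarse_proj_kernel[OF A P R ns]) auto
  ultimately have "?\<Pi> *\<^sub>v x = a"
    unfolding xab using mult_add_distrib_mat_vec[OF Pi a b] a by simp
  then have "(1\<^sub>m n - ?\<Pi>) *\<^sub>v x = b"
    unfolding one_minus_mult_vec[OF Pi x] using xab a b by (intro eq_vecI) auto
  then show ?thesis using cb i by simp
qed

end

section \<open>Application to the two-grid error operators\<close>

theorem theorem4p4:
  fixes n nc :: nat and A M B V Phat Rhat :: "complex mat" and \<mu> :: "nat \<Rightarrow> real"
  assumes nc: "1 \<le> nc" "nc < n"
    and A: "A \<in> carrier_mat n n" "invertible_mat A"
    and M: "M \<in> carrier_mat n n" "invertible_mat M"
    and B: "hpd n B"
    and contr: "B_norm B (1\<^sub>m n - mat_inv M * A) < 1"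
    and diag: "B_unitary_diagonalization n B (Mhat_inv A M B * B) V
                 (mat_diag n (\<lambda>i. complex_of_real (\<mu> i)))"
    and sorted: "mono_on {..<n} \<mu>"
    and nonsing: "invertible_mat (1\<^sub>m n - Mhat_inv A M B * B)"
    and Phat: "Phat \<in> carrier_mat n nc" "mat_range Phat = mat_range (cols_between V 0 nc)"
    and Rhat: "Rhat \<in> carrier_mat n nc"
      "mat_kernel (mat_adjoint Rhat * A) = mat_range (cols_between V nc n)"
  shows "\<forall>(\<nu>1, \<nu>2) \<in> {(0, 1), (1, 0), (1, 1)}.
    (B_norm B (E_plus A M B \<nu>1 \<nu>2 Phat Rhat))\<^sup>2 = (1 - \<mu> nc) ^ (\<nu>1 + \<nu>2) \<and>
    (\<forall>P R. P \<in> carrier_mat n nc \<and> R \<in> carrier_mat n nc \<and> invertible_mat (mat_adjoint R * A * P)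
       \<longrightarrow> (1 - \<mu> nc) ^ (\<nu>1 + \<nu>2) \<le> (B_norm B (E_plus A M B \<nu>1 \<nu>2 P R))\<^sup>2)"
proof -
  define N where "N = mat_inv M * A"
  define S where "S = 1\<^sub>m n - N"
  have Minv: "mat_inv M \<in> carrier_mat n n" by (rule mat_inv_inverts(1)[OF M])
  have N: "N \<in> carrier_mat n n" unfolding N_def using Minv A(1) by (rule mult_carrier_mat)
  have S: "S \<in> carrier_mat n n" unfolding S_def using N by (rule minus_carrier_mat)
  interpret B_unitary_basis n B V
    using B diag unfolding B_unitary_diagonalization_def by unfold_locales auto
  have S_adj: "1\<^sub>m n - B_adjoint B N = B_adjoint B S"
    unfolding S_def by (rule B_adjoint_one_minus[OF N, symmetric])
  have SS: "1\<^sub>m n - Mhat_inv A M B * B = S * B_adjoint B S"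
    unfolding S_def N_def by (rule one_minus_Mhat_inv[OF A(1) Minv])
  have dg: "Mhat_inv A M B * B = V * mat_diag n (\<lambda>i. complex_of_real (\<mu> i)) * mat_inv V"
    using diag unfolding B_unitary_diagonalization_def by blast
  have MB: "Mhat_inv A M B * B \<in> carrier_mat n n"
    unfolding dg mat_inv_V
    by (intro mult_carrier_mat[OF _ VB_carrier] mult_carrier_mat[OF V_carrier]) simp
  \<comment> \<open>Sorted eigenvalues make \<open>1 - \<mu> i\<close> decreasing. Indices start at
    0, so the entry at \<open>nc\<close> belongs to the eigenvalue with 1-based index
    \<open>nc + 1\<close>.\<close>
  interpret smoothed_error n B V S "\<lambda>i. 1 - \<mu> i"
  proof
    show "S \<in> carrier_mat n n" by (rule S)
    show "1 - \<mu> j \<le> 1 - \<mu> i" if "i \<le> j" "j < n" for i j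
      using that sorted by (simp add: monotone_on_def)
    show "coord (S *\<^sub>v (B_adjoint B S *\<^sub>v x)) $ i = of_real (1 - \<mu> i) * coord x $ i"
      if x: "x \<in> carrier_vec n" and i: "i < n" for x i
    proof -
      have "S *\<^sub>v (B_adjoint B S *\<^sub>v x) = x - (Mhat_inv A M B * B) *\<^sub>v x"
        using one_minus_mult_vec[OF MB x] assoc_mult_mat_vec[OF S B_adjoint_carrier[OF S] x]
        unfolding SS by simp
      then show ?thesis
        using coord_diagonalized[OF dg x i] x i mult_mat_vec_carrier[OF MB x]
        by (simp add: coord_minus algebra_simps)
    qed
  qed
  let ?Q = "\<lambda>P R. 1\<^sub>m n - coarse_proj A P R"
  have E: "E_plus A M B 0 1 P R = T * ?Q P R" "E_plus A M B 1 0 P R = ?Q P R * S"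
    "E_plus A M B 1 1 P R = T * ?Q P R * S" if "coarse_proj A P R \<in> carrier_mat n n" for P R
  proof -
    have Q: "?Q P R \<in> carrier_mat n n" using that by (rule minus_carrier_mat)
    have TQ: "T * ?Q P R \<in> carrier_mat n n" by (rule mult_carrier_mat[OF T_carrier Q])
    have dims: "dim_row A = n" "dim_row S = n" "dim_row T = n"
      by (rule carrier_matD(1)[OF A(1)] carrier_matD(1)[OF S] carrier_matD(1)[OF T_carrier])+
    show "E_plus A M B 0 1 P R = T * ?Q P R" "E_plus A M B 1 0 P R = ?Q P R * S"
      "E_plus A M B 1 1 P R = T * ?Q P R * S"
      unfolding E_plus_def Let_def N_def[symmetric] dims(1) S_adj S_def[symmetric]
      by (simp_all only: One_nat_def pow_mat.simps dims left_mult_one_mat[OF T_carrier]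
          left_mult_one_mat[OF S] left_mult_one_mat[OF Q] right_mult_one_mat[OF TQ])
  qed
  have lower: "1 - \<mu> nc \<le> (B_norm B (T * ?Q P R))\<^sup>2"
    "1 - \<mu> nc \<le> (B_norm B (?Q P R * S))\<^sup>2"
    "(1 - \<mu> nc)\<^sup>2 \<le> (B_norm B (T * ?Q P R * S))\<^sup>2"
    if P: "P \<in> carrier_mat n nc" and R: "R \<in> carrier_mat n nc"
      and ns: "invertible_mat (mat_adjoint R * A * P)" for P R
  proof -
    have Pi: "coarse_proj A P R \<in> carrier_mat n n" by (rule coarse_proj_carrier[OF A(1) P R ns])
    then have Q: "?Q P R \<in> carrier_mat n n" by (rule minus_carrier_mat)
    \<comment> \<open>Two systems of \<open>nc\<close> equations are used: \<open>F\<close> cuts out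
      vectors annihilated by the coarse projection, and \<open>G\<close> cuts out vectors that are
      \<open>B\<close>-orthogonal to the range of \<open>P\<close>. Having \<open>nc\<close>
      equations is what places the bound at index \<open>nc\<close>.\<close>
    have F: "mat_adjoint R * A \<in> carrier_mat nc n" using R A(1) by (rule mat_adjoint_mult_carrier)
    have G: "mat_adjoint P * B \<in> carrier_mat nc n" using P B_carrier by (rule mat_adjoint_mult_carrier)
    have fixed: "?Q P R *\<^sub>v x = x"
      if "x \<in> carrier_vec n" "(mat_adjoint R * A) *\<^sub>v x = 0\<^sub>v nc" for x
      using one_minus_mult_vec[OF Pi that(1)] coarse_proj_kernel[OF A(1) P R ns that] that(1) by simp
    show "1 - \<mu> nc \<le> (B_norm B (T * ?Q P R))\<^sup>2" by (rule norm_post_ge[OF Q nc(2) F fixed])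
    show "1 - \<mu> nc \<le> (B_norm B (?Q P R * S))\<^sup>2"
      by (rule norm_pre_ge[OF Q nc(2) G]) (rule coarse_proj_adjoint_fixed[OF A(1) P R ns])
    show "(1 - \<mu> nc)\<^sup>2 \<le> (B_norm B (T * ?Q P R * S))\<^sup>2" by (rule norm_both_ge[OF Q nc(2) F fixed])
  qed
  have nc_le: "nc \<le> n" using nc by simp
  note ns = hat_coarse_nonsingular[OF A(1) Phat(1) Rhat(1) nc_le Phat(2) Rhat(2)]
  note trunc = hat_coarse_truncates[OF A(1) Phat(1) Rhat(1) nc_le Phat(2) Rhat(2)]
  note Pi = coarse_proj_carrier[OF A(1) Phat(1) Rhat(1) ns]
  have Q: "?Q Phat Rhat \<in> carrier_mat n n" using Pi by (rule minus_carrier_mat)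
  have upper: "(B_norm B (T * ?Q Phat Rhat))\<^sup>2 \<le> 1 - \<mu> nc"
    "(B_norm B (?Q Phat Rhat * S))\<^sup>2 \<le> 1 - \<mu> nc"
    "(B_norm B (T * ?Q Phat Rhat * S))\<^sup>2 \<le> (1 - \<mu> nc)\<^sup>2"
    by ((rule norm_post_le[OF Q nc(2)] norm_pre_le[OF Q nc(2)] norm_both_le[OF Q nc(2)],
          erule (1) trunc)+)
  \<comment> \<open>The optimal pair is itself admissible, so the general lower bound meets its own
    upper bound.\<close>
  have exact: "(B_norm B (E_plus A M B 0 1 Phat Rhat))\<^sup>2 = 1 - \<mu> nc"
    "(B_norm B (E_plus A M B 1 0 Phat Rhat))\<^sup>2 = 1 - \<mu> nc"
    "(B_norm B (E_plus A M B 1 1 Phat Rhat))\<^sup>2 = (1 - \<mu> nc)\<^sup>2"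
    unfolding E[OF Pi]
    by (intro order_antisym upper lower[OF Phat(1) Rhat(1) ns])+
  have "1 - \<mu> nc \<le> (B_norm B (E_plus A M B 0 1 P R))\<^sup>2 \<and>
      1 - \<mu> nc \<le> (B_norm B (E_plus A M B 1 0 P R))\<^sup>2 \<and>
      (1 - \<mu> nc)\<^sup>2 \<le> (B_norm B (E_plus A M B 1 1 P R))\<^sup>2"
    if "P \<in> carrier_mat n nc" "R \<in> carrier_mat n nc" "invertible_mat (mat_adjoint R * A * P)" for P R
    unfolding E[OF coarse_proj_carrier[OF A(1) that]] using lower[OF that] by blast
  then show ?thesis
    using exact
    by (simp only: ball_simps prod.case add_0_left add_0_right one_add_one power_one_right simp_thms)
      blast
qed

end
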